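(* Let $\mathcal{F}$ be a $k$-dimensional $M$-part Sperner multi-family with parameters $\{L_P:P\in\binom{[M]}{k}\}$ on $X=X_1\uplus\cdots\uplus X_M$, with profile matrix $(p_{i_1,\ldots,i_M})_{(i_1,\ldots,i_M)\in\pi_M}$. Then for every $P\in\binom{[M]}{k}$, $$\sum_{(i_1,\ldots,i_M)\in\pi_M}\frac{p_{i_1,\ldots,i_M}}{\prod_{j=1}^M\binom{m_j}{i_j}}\le \frac{L_P}{\prod_{j\in P}n_j}\prod_{j=1}^M n_j.$$
   Context: $X$ is a finite set with a fixed partition $X=X_1\uplus\cdots\uplus X_M$, $|X_i|=m_i$, and $n_i=m_i+1$. For a positive integer $n$, $[n]=\{1,\ldots,n\}$, $[n]^{\star}=\{0,\ldots,n-1\}$, and $\pi_M=\prod_{i=1}^M[n_i]^{\star}$. A multi-family of subsets of $X$ is a multiset of subsets of $X$; $\#[F,\mathcal{F}]$ denotes the multiplicity of $F$ in $\mathcal{F}$ and all counts are with multiplicity. Fix $k\in[M]$ and positive integers $L_P$ for $P\in\binom{[M]}{k}$. $\mathcal{F}$ is a $k$-dimensional $M$-part Sperner multi-family with parameters $\{L_P\}$ if for every $P\in\binom{[M]}{k}$, every choice of chains $\mathcal{C}_j$ (families of subsets of $X_j$ totally ordered by inclusion) for $j\in P$, and every choice of sets $D_i\subseteq X_i$ for $i\in[M]\setminus P$, the number of members $F$ of $\mathcal{F}$ (counted with multiplicity) with $F\cap X_j\in\mathcal{C}_j$ for all $j\in P$ and $F\cap X_i=D_i$ for all $i\notin P$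 is at most $L_P$. The profile vector of $F\subseteq X$ is $(|F\cap X_1|,\ldots,|F\cap X_M|)\in\pi_M$, and the profile matrix of $\mathcal{F}$ has entries $p_{i_1,\ldots,i_M}$ = number of members of $\mathcal{F}$ (with multiplicity) with profile vector $(i_1,\ldots,i_M)$. *)

theory Defs
  imports Complex_Main "HOL-Library.Multiset" "HOL-Library.FuncSet" "HOL-Library.Disjoint_Sets"
begin

text \<open>
  The parts of an \<open>M\<close>-part set are indexed by \<open>{1..M}\<close>; values of the indexing function
  outside this range are irrelevant. Parts may be empty.
\<close>

definition M_partition :: "nat \<Rightarrow> 'a set \<Rightarrow> (nat \<Rightarrow> 'a set) \<Rightarrow> bool" where
  "M_partition M X Xs \<longleftrightarrow> disjoint_family_on Xs {1..M} \<and> X = (\<Union>i\<in>{1..M}. Xs i)"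

definition index_subsets :: "nat \<Rightarrow> nat \<Rightarrow> nat set set" where
  "index_subsets M k = {P. P \<subseteq> {1..M} \<and> card P = k}"

definition sperner_multi_family ::
  "nat \<Rightarrow> nat \<Rightarrow> 'a set \<Rightarrow> (nat \<Rightarrow> 'a set) \<Rightarrow> (nat set \<Rightarrow> nat) \<Rightarrow> 'a set multiset \<Rightarrow> bool"
where
  "sperner_multi_family k M X Xs L \<F> \<longleftrightarrow>
     (\<forall>F \<in># \<F>. F \<subseteq> X) \<and>
     (\<forall>P \<in> index_subsets M k. \<forall>C D.
        (\<forall>j\<in>P. subset.chain (Pow (Xs j)) (C j)) \<longrightarrow>
        (\<forall>i\<in>{1..M} - P. D i \<subseteq> Xs i) \<longrightarrow>
        size {# F \<in># \<F>. (\<forall>j\<in>P. F \<inter> Xs j \<in> C j) \<and> (\<forall>i\<in>{1..M} - P. F \<inter> Xs i = D i) #} \<le> L P)"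

text \<open>
  An \<open>M\<close>-tuple of naturals is a function that is \<open>undefined\<close> outside \<open>{1..M}\<close>, so that
  equality of tuples is equality of functions.
\<close>

definition profile_space :: "nat \<Rightarrow> (nat \<Rightarrow> nat) \<Rightarrow> (nat \<Rightarrow> nat) set" where
  "profile_space M n = (\<Pi>\<^sub>E j\<in>{1..M}. {0..<n j})"

definition profile_vector :: "nat \<Rightarrow> (nat \<Rightarrow> 'a set) \<Rightarrow> 'a set \<Rightarrow> (nat \<Rightarrow> nat)" where
  "profile_vector M Xs F = (\<lambda>j\<in>{1..M}. card (F \<inter> Xs j))"

definition profile_matrix ::
  "nat \<Rightarrow> (nat \<Rightarrow> 'a set) \<Rightarrow> 'a set multiset \<Rightarrow> (nat \<Rightarrow> nat) \<Rightarrow> nat" where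
  "profile_matrix M Xs \<F> i = size {# F \<in># \<F>. profile_vector M Xs F = i #}"

end

theory Submission
  imports Defs "HOL-Combinatorics.Multiset_Permutations"
begin

text \<open>
  Averaging over maximal chains, as in the proof of the LYM inequality. A uniformly random maximal
  chain of subsets of \<open>S\<close> contains a given \<open>A \<subseteq> S\<close> with probability \<open>1 / (|S| choose |A|)\<close>; the
  singleton families \<open>{D}\<close> with \<open>D \<subseteq> S\<close>, weighted by \<open>1 / (|S| choose |D|)\<close>, hit \<open>A\<close> with
  the same total weight, but their weights add up to \<open>|S| + 1\<close> instead of \<open>1\<close>. Take
  the random chain in the parts indexed by \<open>P\<close> and the weighted singletons in the other parts,
  independently. Then the left-hand side is the weighted number of members of \<open>\<F>\<close> that are
  hit in every part, and each single choice of families hits at most \<open>L P\<close> members.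
\<close>

text \<open>For a permutation \<open>xs\<close> of a finite set \<open>S\<close> this is a maximal
  chain of subsets of \<open>S\<close>, running from the empty set to \<open>S\<close>; a uniformly
  random permutation thus stands in for a uniformly random maximal chain.\<close>

definition prefix_chain :: "'a list \<Rightarrow> 'a set set" where
  "prefix_chain xs = (\<lambda>i. set (take i xs)) ` {..length xs}"

lemma subset_chain_prefix_chain: "subset.chain (Pow (set xs)) (prefix_chain xs)"
proof -
  have "set (take i xs) \<subseteq> set (take j xs) \<or> set (take j xs) \<subseteq> set (take i xs)" for i j
    using set_take_subset_set_take[of i j xs] set_take_subset_set_take[of j i xs] by linarith
  then show ?thesis
    unfolding subset_chain_def prefix_chain_def by (auto dest: in_set_takeD)
qed

text \<open>A chain of prefixes passes through \<open>A\<close> exactly when the list runs through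
  all of \<open>A\<close> before any element of \<open>S - A\<close>, so cutting it there yields two
  independent permutations.\<close>

lemma permutations_with_prefix_set:
  assumes "finite S" "A \<subseteq> S"
  shows "{xs \<in> permutations_of_set S. A \<in> prefix_chain xs} =
    (\<lambda>(ys, zs). ys @ zs) ` (permutations_of_set A \<times> permutations_of_set (S - A))"
    (is "?l = ?r")
proof (intro equalityI subsetI)
  fix xs assume "xs \<in> ?l"
  then obtain i where i: "set xs = S" "distinct xs" "A = set (take i xs)"
    by (auto simp: prefix_chain_def permutations_of_set_def)
  have "set (take i xs) \<union> set (drop i xs) = S"
    using i(1) by (metis append_take_drop_id set_append)
  moreover have "set (take i xs) \<inter> set (drop i xs) = {}"
    using i(2) by (simp add: set_take_disj_set_drop_if_distinct)
  ultimately have "set (drop i xs) = S - A"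
    using i(3) by blast
  then have "(take i xs, drop i xs) \<in> permutations_of_set A \<times> permutations_of_set (S - A)"
    using i by (simp add: permutations_of_set_def)
  then show "xs \<in> ?r"
    by (force intro: image_eqI[where x = "(take i xs, drop i xs)"])
next
  fix xs assume "xs \<in> ?r"
  then obtain ys zs where x: "xs = ys @ zs" "set ys = A" "distinct ys"
      "set zs = S - A" "distinct zs"
    by (auto simp: permutations_of_set_def)
  have "A = set (take (length ys) xs)" "length ys \<le> length xs"
    using x by auto
  then have "A \<in> prefix_chain xs"
    unfolding prefix_chain_def by blast
  then show "xs \<in> ?l"
    using x assms by (auto simp: permutations_of_set_def)
qed

lemma card_permutations_with_prefix_set:
  assumes "finite S" "A \<subseteq> S"
  shows "card {xs \<in> permutations_of_set S. A \<in> prefix_chain xs} =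
    fact (card A) * fact (card S - card A)"
proof -
  \<comment> \<open>Every first component has length \<open>card A\<close>, which fixes the cutting
    point of a concatenation.\<close>
  have "inj_on (\<lambda>(ys, zs). ys @ zs) (permutations_of_set A \<times> permutations_of_set (S - A))"
    by (auto simp: inj_on_def dest!: length_finite_permutations_of_set)
  moreover have "finite A"
    using assms finite_subset by blast
  ultimately show ?thesis
    using assms
    by (simp add: permutations_with_prefix_set card_image card_cartesian_product card_Diff_subset)
qed

lemma chain_weights:
  assumes "finite (S :: 'a set)"
  obtains T :: "'a set set set" and w :: "'a set set \<Rightarrow> real"
  where "finite T" "\<And>C. C \<in> T \<Longrightarrow> subset.chain (Pow S) C" "\<And>C. w C \<ge> 0" "sum w T = 1"
    "\<And>A. A \<subseteq> S \<Longrightarrow> (\<Sum>C\<in>T. w C * of_bool (A \<in> C)) = 1 / real (card S choose card A)"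
proof
  let ?perms = "permutations_of_set S"
  let ?T = "prefix_chain ` ?perms"
  \<comment> \<open>The push-forward of the uniform distribution on permutations. Being a sum over
    fibres, it lets \<open>sum.image_gen\<close> turn sums over chains into sums over
    permutations.\<close>
  let ?w = "\<lambda>C. \<Sum>xs\<in>{xs \<in> ?perms. prefix_chain xs = C}. 1 / fact (card S) :: real"
  show "finite ?T"
    by simp
  show "subset.chain (Pow S) C" if "C \<in> ?T" for C
    using that subset_chain_prefix_chain by (auto simp: permutations_of_set_def)
  show "?w C \<ge> 0" for C
    by (simp add: sum_nonneg)
  have "sum ?w ?T = (\<Sum>xs\<in>?perms. 1 / fact (card S))"
    by (rule sum.image_gen[symmetric]) simp
  also have "\<dots> = 1"
    using assms by simp
  finally show "sum ?w ?T = 1" .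
  show "(\<Sum>C\<in>?T. ?w C * of_bool (A \<in> C)) = 1 / real (card S choose card A)" if A: "A \<subseteq> S" for A
  proof -
    have "(\<Sum>C\<in>?T. ?w C * of_bool (A \<in> C)) =
        (\<Sum>C\<in>?T. \<Sum>xs\<in>{xs \<in> ?perms. prefix_chain xs = C}.
          of_bool (A \<in> prefix_chain xs) / fact (card S))"
      by (intro sum.cong refl) (simp add: sum_distrib_right)
    also have "\<dots> = (\<Sum>xs\<in>?perms. of_bool (A \<in> prefix_chain xs) / fact (card S))"
      by (rule sum.image_gen[symmetric]) simp
    also have "\<dots> = real (card {xs \<in> ?perms. A \<in> prefix_chain xs}) / fact (card S)"
      by (simp add: sum_divide_distrib[symmetric] Int_def)
    also have "\<dots> = 1 / real (card S choose card A)"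
      using A assms
      by (simp add: card_permutations_with_prefix_set binomial_fact card_mono)
    finally show ?thesis .
  qed
qed

text \<open>Each size from 0 to \<open>card S\<close> contributes exactly 1, because the number of
  subsets of that size cancels their common weight.\<close>

lemma sum_inverse_binomial_Pow:
  assumes "finite S"
  shows "(\<Sum>D\<in>Pow S. 1 / real (card S choose card D)) = real (card S + 1)"
proof -
  have "(\<Sum>D\<in>Pow S. 1 / real (card S choose card D)) =
      (\<Sum>i\<le>card S. \<Sum>D\<in>{D \<in> Pow S. card D = i}. 1 / real (card S choose card D))"
    using assms by (intro sum.group[symmetric]) (auto intro: card_mono)
  also have "\<dots> = (\<Sum>i\<le>card S. 1)"
  proof (intro sum.cong refl)
    fix i assume "i \<in> {..card S}"
    then have "card S choose i > 0"
      by simp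
    then show "(\<Sum>D\<in>{D \<in> Pow S. card D = i}. 1 / real (card S choose card D)) = 1"
      using n_subsets[OF assms, of i] by simp
  qed
  finally show ?thesis
    by simp
qed

text \<open>Only the family \<open>{A}\<close> contributes to the hitting weight of
  \<open>A\<close>. The last property has the same form as in \<open>chain_weights\<close>, so that
  both kinds of parts can enter one product.\<close>

lemma singleton_weights:
  assumes "finite (S :: 'a set)"
  obtains T :: "'a set set set" and w :: "'a set set \<Rightarrow> real"
  where "finite T" "\<And>C. C \<in> T \<Longrightarrow> \<exists>D\<subseteq>S. C = {D}" "\<And>C. w C \<ge> 0" "sum w T = real (card S + 1)"
    "\<And>A. A \<subseteq> S \<Longrightarrow> (\<Sum>C\<in>T. w C * of_bool (A \<in> C)) = 1 / real (card S choose card A)"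
proof
  let ?T = "(\<lambda>D. {D}) ` Pow S"
  let ?w = "\<lambda>C. 1 / real (card S choose card (the_elem C))"
  show "finite ?T"
    using assms by simp
  show "\<exists>D\<subseteq>S. C = {D}" if "C \<in> ?T" for C
    using that by auto
  show "?w C \<ge> 0" for C
    by simp
  show "sum ?w ?T = real (card S + 1)"
    using sum_inverse_binomial_Pow[OF assms] by (simp add: sum.reindex)
  show "(\<Sum>C\<in>?T. ?w C * of_bool (A \<in> C)) = 1 / real (card S choose card A)" if "A \<subseteq> S" for A
  proof -
    have "(\<Sum>C\<in>?T. ?w C * of_bool (A \<in> C)) =
        (\<Sum>D\<in>Pow S. if D = A then 1 / real (card S choose card A) else 0)"
      by (auto simp: sum.reindex intro!: sum.cong)
    then show ?thesis
      using that assms by simp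
  qed
qed

text \<open>Double counting: each \<open>x\<close> lies in exactly one fibre of \<open>h\<close>.
  Used with \<open>h\<close> the profile vector, to pass from a sum over profiles to a sum over
  members.\<close>

lemma sum_size_fibers:
  fixes g :: "'b \<Rightarrow> real"
  assumes "finite I" "\<And>x. x \<in># N \<Longrightarrow> h x \<in> I"
  shows "(\<Sum>i\<in>I. real (size {#x \<in># N. h x = i#}) * g i) = (\<Sum>x\<in>#N. g (h x))"
  using assms(2)
proof (induction N)
  case empty
  then show ?case by simp
next
  case (add x N)
  have "(\<Sum>i\<in>I. real (size {#y \<in># add_mset x N. h y = i#}) * g i) =
      (\<Sum>i\<in>I. real (size {#y \<in># N. h y = i#}) * g i + (if i = h x then g (h x) else 0))"
    by (intro sum.cong refl) (auto simp: algebra_simps)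
  also have "\<dots> = (\<Sum>y\<in>#N. g (h y)) + g (h x)"
    using add assms(1) by (simp add: sum.distrib)
  finally show ?case
    by simp
qed

lemma sum_mset_sum_swap:
  fixes f :: "'a \<Rightarrow> 'b \<Rightarrow> real"
  shows "(\<Sum>x\<in>#N. \<Sum>t\<in>T. f x t) = (\<Sum>t\<in>T. \<Sum>x\<in>#N. f x t)"
  by (induction N) (simp_all add: sum.distrib)

lemma sum_mset_of_bool:
  "(\<Sum>x\<in>#N. c * of_bool (Q x)) = (c :: real) * real (size {#x \<in># N. Q x#})"
  by (induction N) (simp_all add: algebra_simps)

lemma prod_of_bool:
  "finite J \<Longrightarrow> (\<Prod>j\<in>J. of_bool (Q j) :: real) = of_bool (\<forall>j\<in>J. Q j)"
  by (induction J rule: finite_induct) auto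

text \<open>Multiplying out the product gives a sum over choices \<open>t\<close> of one family per
  part. After exchanging the sums, each \<open>t\<close> contributes its nonnegative weight times a
  count of at most \<open>l\<close>, and the weights factor again.\<close>

lemma weighted_count_le:
  fixes w :: "'i \<Rightarrow> 'b \<Rightarrow> real"
  assumes "finite J" and "\<And>j. j \<in> J \<Longrightarrow> finite (T j)" and "\<And>j C. j \<in> J \<Longrightarrow> w j C \<ge> 0"
    and le: "\<And>t. t \<in> Pi\<^sub>E J T \<Longrightarrow> size {#x \<in># N. \<forall>j\<in>J. R j x (t j)#} \<le> l"
  shows "(\<Sum>x\<in>#N. \<Prod>j\<in>J. \<Sum>C\<in>T j. w j C * of_bool (R j x C)) \<le> real l * (\<Prod>j\<in>J. sum (w j) (T j))"
proof -
  have expand: "(\<Prod>j\<in>J. \<Sum>C\<in>T j. f j C) = (\<Sum>t\<in>Pi\<^sub>E J T. \<Prod>j\<in>J. f j (t j))"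
    for f :: "'i \<Rightarrow> 'b \<Rightarrow> real"
    using assms(1,2) by (simp add: prod_sum_PiE)
  have "(\<Sum>x\<in>#N. \<Prod>j\<in>J. \<Sum>C\<in>T j. w j C * of_bool (R j x C)) =
      (\<Sum>x\<in>#N. \<Sum>t\<in>Pi\<^sub>E J T. (\<Prod>j\<in>J. w j (t j)) * of_bool (\<forall>j\<in>J. R j x (t j)))"
    using assms(1) by (simp only: expand prod.distrib prod_of_bool)
  also have "\<dots> = (\<Sum>t\<in>Pi\<^sub>E J T. (\<Prod>j\<in>J. w j (t j)) * real (size {#x \<in># N. \<forall>j\<in>J. R j x (t j)#}))"
    by (simp only: sum_mset_sum_swap sum_mset_of_bool)
  also have "\<dots> \<le> (\<Sum>t\<in>Pi\<^sub>E J T. (\<Prod>j\<in>J. w j (t j)) * real l)"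
    using le assms(3) by (intro sum_mono mult_left_mono prod_nonneg) auto
  also have "\<dots> = real l * (\<Prod>j\<in>J. sum (w j) (T j))"
    by (simp add: expand sum_distrib_left mult.commute)
  finally show ?thesis .
qed

theorem theorem4p1:
  fixes X :: "'a set" and Xs :: "nat \<Rightarrow> 'a set" and M k :: nat
    and m n :: "nat \<Rightarrow> nat" and L :: "nat set \<Rightarrow> nat" and \<F> :: "'a set multiset"
  assumes "finite X"
    and "M_partition M X Xs"
    and "\<And>i. i \<in> {1..M} \<Longrightarrow> m i = card (Xs i)"
    and "\<And>i. i \<in> {1..M} \<Longrightarrow> n i = m i + 1"
    and "k \<in> {1..M}"
    and "\<And>P. P \<in> index_subsets M k \<Longrightarrow> L P > 0"
    and "sperner_multi_family k M X Xs L \<F>"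
  shows "\<forall>P \<in> index_subsets M k.
    (\<Sum>i \<in> profile_space M n.
        real (profile_matrix M Xs \<F> i) / (\<Prod>j=1..M. real (m j choose i j)))
      \<le> real (L P) / (\<Prod>j\<in>P. real (n j)) * (\<Prod>j=1..M. real (n j))"
proof
  fix P assume P: "P \<in> index_subsets M k"
  then have PM: "P \<subseteq> {1..M}"
    by (simp add: index_subsets_def)
  have fin: "finite (Xs j)" if "j \<in> {1..M}" for j
    using assms(1,2) that by (auto simp: M_partition_def)

  \<comment> \<open>One specification covers both kinds of parts: the total mass depends on whether
    \<open>j\<close> is in \<open>P\<close>, the mass hitting a given set does not.\<close>
  define weights where "weights j T w \<longleftrightarrow>
      finite T \<and> (\<forall>C\<in>T. if j \<in> P then subset.chain (Pow (Xs j)) C else \<exists>D\<subseteq>Xs j. C = {D}) \<and>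
      (\<forall>C. w C \<ge> 0) \<and> sum w T = (if j \<in> P then 1 else real (n j)) \<and>
      (\<forall>A\<subseteq>Xs j. (\<Sum>C\<in>T. w C * of_bool (A \<in> C)) = 1 / real (m j choose card A))"
    for j T and w :: "'a set set \<Rightarrow> real"
  have "\<exists>T w. weights j T w" if j: "j \<in> {1..M}" for j
  proof (cases "j \<in> P")
    case True
    obtain T w where "finite T" "\<And>C. C \<in> T \<Longrightarrow> subset.chain (Pow (Xs j)) C"
      "\<And>C. w C \<ge> 0" "sum w T = 1"
      "\<And>A. A \<subseteq> Xs j \<Longrightarrow> (\<Sum>C\<in>T. w C * of_bool (A \<in> C)) = 1 / real (card (Xs j) choose card A)"
      using chain_weights[OF fin[OF j]] by blast
    then have "weights j T w"
      unfolding weights_def by (simp add: True assms(3)[OF j])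
    then show ?thesis
      by blast
  next
    case False
    obtain T w where "finite T" "\<And>C. C \<in> T \<Longrightarrow> \<exists>D\<subseteq>Xs j. C = {D}"
      "\<And>C. w C \<ge> 0" "sum w T = real (card (Xs j) + 1)"
      "\<And>A. A \<subseteq> Xs j \<Longrightarrow> (\<Sum>C\<in>T. w C * of_bool (A \<in> C)) = 1 / real (card (Xs j) choose card A)"
      using singleton_weights[OF fin[OF j]] by blast
    then have "weights j T w"
      unfolding weights_def by (simp add: False assms(3,4)[OF j])
    then show ?thesis
      by blast
  qed
  then obtain T w where Tw: "\<And>j. j \<in> {1..M} \<Longrightarrow> weights j (T j) (w j)"
    by metis
  then have T: "\<And>j. j \<in> {1..M} \<Longrightarrow> finite (T j)"
      "\<And>j C. j \<in> {1..M} \<Longrightarrow> C \<in> T j \<Longrightarrow>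
        if j \<in> P then subset.chain (Pow (Xs j)) C else \<exists>D\<subseteq>Xs j. C = {D}"
    and w: "\<And>j C. j \<in> {1..M} \<Longrightarrow> w j C \<ge> 0"
      "\<And>j. j \<in> {1..M} \<Longrightarrow> sum (w j) (T j) = (if j \<in> P then 1 else real (n j))"
      "\<And>j A. j \<in> {1..M} \<Longrightarrow> A \<subseteq> Xs j \<Longrightarrow>
        (\<Sum>C\<in>T j. w j C * of_bool (A \<in> C)) = 1 / real (m j choose card A)"
    unfolding weights_def by blast+

  \<comment> \<open>Sizes range over 0 to \<open>m j\<close>, which is \<open>{0..<n j}\<close>
    since \<open>n j = m j + 1\<close>.\<close>
  have prof: "profile_vector M Xs F \<in> profile_space M n" for F
    using fin assms(3,4)
    by (auto simp: profile_vector_def profile_space_def less_Suc_eq_le intro!: card_mono)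
  have "(\<Sum>i \<in> profile_space M n.
        real (profile_matrix M Xs \<F> i) / (\<Prod>j=1..M. real (m j choose i j))) =
      (\<Sum>F\<in>#\<F>. 1 / (\<Prod>j=1..M. real (m j choose profile_vector M Xs F j)))"
    using sum_size_fibers[of "profile_space M n" \<F> "profile_vector M Xs"
        "\<lambda>i. 1 / (\<Prod>j=1..M. real (m j choose i j))"] prof
    by (simp add: profile_matrix_def profile_space_def finite_PiE)
  \<comment> \<open>Each reciprocal binomial is read backwards as the mass of the families
    containing the trace of \<open>F\<close> on \<open>Xs j\<close>.\<close>
  also have "\<dots> = (\<Sum>F\<in>#\<F>. \<Prod>j\<in>{1..M}. \<Sum>C\<in>T j. w j C * of_bool (F \<inter> Xs j \<in> C))"
    by (intro arg_cong[where f = sum_mset] image_mset_cong)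
       (simp add: w(3) profile_vector_def prod_dividef)
  also have "\<dots> \<le> real (L P) * (\<Prod>j\<in>{1..M}. sum (w j) (T j))"
  proof (rule weighted_count_le)
    fix t assume t: "t \<in> Pi\<^sub>E {1..M} T"
    \<comment> \<open>Outside \<open>P\<close> the chosen family is a singleton, so membership in it
      is equality with \<open>D i\<close>; this gives the count the form bounded in
      \<open>sperner_multi_family_def\<close>.\<close>
    define D where "D i = the_elem (t i)" for i
    have chain: "\<forall>j\<in>P. subset.chain (Pow (Xs j)) (t j)"
      using t T(2) PM by (metis PiE_mem subsetD)
    have single: "D i \<subseteq> Xs i \<and> t i = {D i}" if "i \<in> {1..M} - P" for i
      using T(2)[of i "t i"] PiE_mem[OF t, of i] that by (auto simp: D_def)
    have "{#F \<in># \<F>. \<forall>j\<in>{1..M}. F \<inter> Xs j \<in> t j#} =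
        {#F \<in># \<F>. (\<forall>j\<in>P. F \<inter> Xs j \<in> t j) \<and> (\<forall>i\<in>{1..M} - P. F \<inter> Xs i = D i)#}"
    proof (intro filter_mset_cong refl)
      fix F
      have "(\<forall>j\<in>{1..M}. F \<inter> Xs j \<in> t j) \<longleftrightarrow>
          (\<forall>j\<in>P. F \<inter> Xs j \<in> t j) \<and> (\<forall>i\<in>{1..M} - P. F \<inter> Xs i \<in> t i)"
        using PM by blast
      also have "(\<forall>i\<in>{1..M} - P. F \<inter> Xs i \<in> t i) \<longleftrightarrow> (\<forall>i\<in>{1..M} - P. F \<inter> Xs i = D i)"
        by (intro ball_cong refl) (metis single singleton_iff)
      finally show "(\<forall>j\<in>{1..M}. F \<inter> Xs j \<in> t j) \<longleftrightarrow>
          (\<forall>j\<in>P. F \<inter> Xs j \<in> t j) \<and> (\<forall>i\<in>{1..M} - P. F \<inter> Xs i = D i)" .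
    qed
    then show "size {#F \<in># \<F>. \<forall>j\<in>{1..M}. F \<inter> Xs j \<in> t j#} \<le> L P"
      using assms(7) P chain single unfolding sperner_multi_family_def by simp
  qed (use T(1) w(1) in auto)
  \<comment> \<open>The parts in \<open>P\<close> have total mass 1 and drop out.\<close>
  also have "(\<Prod>j\<in>{1..M}. sum (w j) (T j)) = (\<Prod>j\<in>{1..M} - P. real (n j))"
    using PM by (intro prod.mono_neutral_cong_right) (auto simp: w(2))
  also have "real (L P) * \<dots> = real (L P) / (\<Prod>j\<in>P. real (n j)) * (\<Prod>j=1..M. real (n j))"
  proof -
    \<comment> \<open>Every \<open>n j\<close> with \<open>j\<close> in \<open>P\<close> is a
      successor, so the product over \<open>P\<close> can be cancelled.\<close>
    have "(\<Prod>j\<in>P. real (n j)) \<noteq> 0"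
      using PM assms(4) finite_subset[OF PM] by auto
    then show ?thesis
      by (simp only: prod.subset_diff[OF PM finite_atLeastAtMost]) simp
  qed
  finally show "(\<Sum>i \<in> profile_space M n.
        real (profile_matrix M Xs \<F> i) / (\<Prod>j=1..M. real (m j choose i j)))
      \<le> real (L P) / (\<Prod>j\<in>P. real (n j)) * (\<Prod>j=1..M. real (n j))" .
qed

end
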